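(* Let $\Gamma$ be an uncountable index set. Then $\operatorname{Iso}(c(\Gamma))$ and $\operatorname{Aut}(c(\Gamma))$ are not algebraically reflexive.
   Context: $\Gamma$ is regarded as a discrete space, $\Gamma\cup\{\infty\}$ is its one-point compactification, and $c(\Gamma)=C(\Gamma\cup\{\infty\})=\mathbb K1\oplus c_0(\Gamma)$ is the Banach algebra of continuous $\mathbb K$-valued functions on $\Gamma\cup\{\infty\}$ with the sup-norm ($\mathbb K=\mathbb R$ or $\mathbb C$). For a Banach algebra $\mathscr A$: $\operatorname{Iso}(\mathscr A)$ is the group of all surjective linear isometries; $\operatorname{Aut}(\mathscr A)$ is the group of all continuous (linear) algebra automorphisms; $B(\mathscr A)$ is the algebra of all continuous linear operators on $\mathscr A$. For $\mathscr S\subset B(\mathscr A)$ put $\operatorname{ref}_{al}\mathscr S=\{T\in B(\mathscr A): \text{for every }x\in \mathscr A\text{ there is }L\in\mathscr S\text{ with }Tx=Lx\}$; $\mathscr S$ is algebraically reflexive if $\operatorname{ref}_{al}\mathscr S=\mathscr S$. *)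

theory Defs
  imports "HOL-Analysis.Analysis"
begin

section \<open>The one-point compactification of a discrete space, as a type\<close>

typedef 'g onept = "UNIV :: 'g option set"
  morphisms option_of_onept onept_of_option ..

instantiation onept :: (type) topological_space
begin

definition open_onept :: "'g onept set \<Rightarrow> bool"
  where "open_onept U \<longleftrightarrow>
    openin (Alexandroff_compactification (discrete_topology UNIV)) (option_of_onept ` U)"

instance
proof
  have "range option_of_onept = (UNIV :: 'a option set)"
    using type_definition.Rep_range[OF type_definition_onept] .
  also have "\<dots> = topspace (Alexandroff_compactification (discrete_topology UNIV))"
    by (simp add: UNIV_option_conv)
  finally show "open (UNIV :: 'a onept set)"
    by (simp only: open_onept_def openin_topspace)
  show "open (S \<inter> T)" if "open S" "open T" for S T :: "'a onept set"
    using that by (simp add: open_onept_def image_Int inj_def option_of_onept_inject openin_Int)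
  show "open (\<Union>K)" if "\<forall>S\<in>K. open S" for K :: "'a onept set set"
    using that by (auto simp: open_onept_def image_Union intro!: openin_Union)
qed

end

lemma open_onept_iff:
  fixes U :: "'g onept set"
  shows "open U \<longleftrightarrow> (onept_of_option None \<in> U \<longrightarrow> finite (- U))"
proof -
  have im: "option_of_onept ` U = {x. onept_of_option x \<in> U}"
  proof (rule set_eqI)
    fix x :: "'g option"
    have "option_of_onept (onept_of_option x) = x"
      by (simp add: onept_of_option_inverse)
    then show "x \<in> option_of_onept ` U \<longleftrightarrow> x \<in> {x. onept_of_option x \<in> U}"
      by (metis (mono_tags, lifting) image_iff mem_Collect_eq option_of_onept_inverse)
  qed
  have fin: "finite (- U) \<longleftrightarrow> finite (- {x. onept_of_option x \<in> U})"
  proof -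
    have "- U = onept_of_option ` (- {x. onept_of_option x \<in> U})"
    proof (rule set_eqI)
      fix y :: "'g onept"
      have "y = onept_of_option (option_of_onept y)"
        by (simp add: option_of_onept_inverse)
      then show "y \<in> - U \<longleftrightarrow> y \<in> onept_of_option ` (- {x. onept_of_option x \<in> U})"
        by (metis (no_types, lifting) Compl_iff image_iff mem_Collect_eq)
    qed
    moreover have "inj onept_of_option"
      by (auto simp: inj_def onept_of_option_inject)
    ultimately show ?thesis
      using finite_image_iff[OF inj_on_subset[OF _ subset_UNIV]] by metis
  qed
  let ?V = "{x. onept_of_option x \<in> U}"
  have "open U \<longleftrightarrow> (\<exists>W. ?V = Some ` W) \<or> (\<exists>C. finite C \<and> ?V = insert None (Some ` (- C)))"
    unfolding open_onept_def im openin_Alexandroff_compactification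
    by (auto simp: compactin_discrete_topology Compl_eq_Diff_UNIV)
  also have "\<dots> \<longleftrightarrow> (None \<in> ?V \<longrightarrow> finite (- ?V))"
  proof (cases "None \<in> ?V")
    case True
    have "finite (- ?V) \<longleftrightarrow> (\<exists>C. finite C \<and> ?V = insert None (Some ` (- C)))"
    proof
      assume f: "finite (- ?V)"
      have "?V = insert None (Some ` (- (Some -` (- ?V))))"
      proof (rule set_eqI)
        fix x show "x \<in> ?V \<longleftrightarrow> x \<in> insert None (Some ` (- (Some -` (- ?V))))"
          using True by (cases x) auto
      qed
      moreover have "finite (Some -` (- ?V))"
        using f by (rule finite_vimageI) simp
      ultimately show "\<exists>C. finite C \<and> ?V = insert None (Some ` (- C))" by blast
    next
      assume "\<exists>C. finite C \<and> ?V = insert None (Some ` (- C))"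
      then obtain C where C: "finite C" "?V = insert None (Some ` (- C))" by blast
      have "- ?V \<subseteq> Some ` C"
      proof
        fix x assume "x \<in> - ?V"
        then show "x \<in> Some ` C"
          unfolding C(2) by (cases x) auto
      qed
      then show "finite (- ?V)"
        using C(1) finite_surj by blast
    qed
    with True show ?thesis by blast
  next
    case False
    have "?V = Some ` (Some -` ?V)"
    proof (rule set_eqI)
      fix x show "x \<in> ?V \<longleftrightarrow> x \<in> Some ` (Some -` ?V)"
        using False by (cases x) auto
    qed
    with False show ?thesis by blast
  qed
  finally show ?thesis
    using fin by simp
qed

lemma compact_UNIV_onept: "compact (UNIV :: 'g onept set)"
proof (rule compactI)
  fix \<C> :: "'g onept set set"
  assume op: "\<forall>B\<in>\<C>. open B" and cov: "UNIV \<subseteq> \<Union>\<C>"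
  obtain B where B: "B \<in> \<C>" "onept_of_option None \<in> B"
    using cov by blast
  then have fin: "finite (- B)"
    using op open_onept_iff by blast
  have "\<forall>x. \<exists>B. B \<in> \<C> \<and> x \<in> B"
    using cov by blast
  then obtain h where h: "\<And>x. h x \<in> \<C> \<and> x \<in> h x"
    using choice[of "\<lambda>x B. B \<in> \<C> \<and> x \<in> B"] by blast
  have "UNIV \<subseteq> \<Union>(insert B (h ` (- B)))"
    using h by auto
  then show "\<exists>\<C>'\<subseteq>\<C>. finite \<C>' \<and> UNIV \<subseteq> \<Union>\<C>'"
    using fin B h by (intro exI[of _ "insert B (h ` (- B))"]) auto
qed

text \<open>
  Hence every continuous function on the compactification is bounded, and the library type
  of bounded continuous functions is the space of all continuous functions with the sup-norm.
\<close>

lemma bcontfun_onept_eq: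
  "(bcontfun :: ('g onept \<Rightarrow> 'k::metric_space) set) = {f. continuous_on UNIV f}"
  by (auto simp: bcontfun_def intro!: compact_imp_bounded compact_continuous_image compact_UNIV_onept)

type_synonym ('g, 'k) c_space = "'g onept \<Rightarrow>\<^sub>C 'k"


section \<open>The Banach algebra of bounded continuous functions\<close>

instance bcontfun :: (topological_space, complete_space) complete_space
proof
  fix f :: "nat \<Rightarrow> 'a \<Rightarrow>\<^sub>C 'b"
  assume "Cauchy f"
  then have "uniformly_Cauchy_on UNIV (\<lambda>n. apply_bcontfun (f n))"
    unfolding uniformly_Cauchy_on_def Cauchy_def
    by (metis dist_fun_lt_imp_dist_val_lt)
  then obtain g where "uniform_limit UNIV (\<lambda>n. apply_bcontfun (f n)) g sequentially"
    using Cauchy_uniformly_convergent uniformly_convergent_on_def by blast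
  then show "convergent f"
    by (metis convergentI uniform_limit_bcontfunE sequentially_bot)
qed

instance bcontfun :: (topological_space, banach) banach ..

lemma times_cont:
  fixes f g :: "'a::topological_space \<Rightarrow> 'b::real_normed_algebra"
  assumes "f \<in> bcontfun" "g \<in> bcontfun"
  shows "(\<lambda>x. f x * g x) \<in> bcontfun"
proof -
  obtain F G where FG: "f = apply_bcontfun F" "g = apply_bcontfun G"
    using assms bcontfunE by metis
  have "norm (f x * g x) \<le> norm F * norm G" for x
    unfolding FG by (meson mult_mono norm_bounded norm_ge_zero norm_mult_ineq order_trans)
  then show ?thesis
    using assms by (intro bcontfun_normI) (auto simp: bcontfun_def intro!: continuous_intros)
qed

instantiation bcontfun :: (topological_space, real_normed_algebra) real_normed_algebra
begin

definition times_bcontfun :: "('a \<Rightarrow>\<^sub>C 'b) \<Rightarrow> ('a \<Rightarrow>\<^sub>C 'b) \<Rightarrow> 'a \<Rightarrow>\<^sub>C 'b"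
  where "times_bcontfun f g = Bcontfun (\<lambda>x. f x * g x)"

lemma apply_times_bcontfun [simp]:
  "apply_bcontfun (f * g) x = apply_bcontfun f x * apply_bcontfun (g :: 'a \<Rightarrow>\<^sub>C 'b) x"
  unfolding times_bcontfun_def
  by (subst Bcontfun_inverse[OF times_cont[OF apply_bcontfun apply_bcontfun]]) (rule refl)

instance
proof
  fix f g :: "'a \<Rightarrow>\<^sub>C 'b"
  show "norm (f * g) \<le> norm f * norm g"
  proof (rule norm_bound)
    fix x
    show "norm (apply_bcontfun (f * g) x) \<le> norm f * norm g"
      unfolding apply_times_bcontfun
      by (meson mult_mono norm_bounded norm_ge_zero norm_mult_ineq order_trans)
  qed
qed (auto intro!: bcontfun_eqI simp: algebra_simps)

end

instantiation bcontfun :: (topological_space, real_normed_algebra_1) real_normed_algebra_1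
begin

definition one_bcontfun :: "'a \<Rightarrow>\<^sub>C 'b"
  where "one_bcontfun = const_bcontfun 1"

lemma apply_one_bcontfun [simp]: "apply_bcontfun (1 :: 'a \<Rightarrow>\<^sub>C 'b) x = 1"
  by (simp add: one_bcontfun_def)

instance
proof
  have "norm (1 :: 'a \<Rightarrow>\<^sub>C 'b) \<le> 1"
    by (rule norm_bound) simp
  moreover have "1 \<le> norm (1 :: 'a \<Rightarrow>\<^sub>C 'b)"
    using norm_bounded[of "1 :: 'a \<Rightarrow>\<^sub>C 'b" undefined] by simp
  ultimately show "norm (1 :: 'a \<Rightarrow>\<^sub>C 'b) = 1" by simp
  then show "(0 :: 'a \<Rightarrow>\<^sub>C 'b) \<noteq> 1"
    by (metis norm_zero zero_neq_one)
qed (auto intro!: bcontfun_eqI)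

end

definition scaleK :: "'k \<Rightarrow> ('a::topological_space \<Rightarrow>\<^sub>C 'k::real_normed_field) \<Rightarrow> 'a \<Rightarrow>\<^sub>C 'k"
  where "scaleK c f = const_bcontfun c * f"

lemma apply_scaleK [simp]: "apply_bcontfun (scaleK c f) x = c * apply_bcontfun f x"
  by (simp add: scaleK_def)

lemma vector_space_scaleK: "vector_space scaleK"
  by unfold_locales (auto intro!: bcontfun_eqI simp: algebra_simps)


section \<open>Operators on a Banach algebra over a field of scalars\<close>

text \<open>
  The library's classes of normed spaces are over the reals only; the scalar multiplication
  \<open>s\<close> is an explicit parameter, so that the notions below make sense over the complex
  numbers as well.
\<close>

definition Bop :: "('k::field \<Rightarrow> 'x \<Rightarrow> 'x) \<Rightarrow> ('x::{banach, real_normed_algebra} \<Rightarrow> 'x) set"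
  where "Bop s = {T. Vector_Spaces.linear s s T \<and> continuous_on UNIV T}"

definition Iso :: "('k::field \<Rightarrow> 'x \<Rightarrow> 'x) \<Rightarrow> ('x::{banach, real_normed_algebra} \<Rightarrow> 'x) set"
  where "Iso s = {T. Vector_Spaces.linear s s T \<and> surj T \<and> (\<forall>x y. dist (T x) (T y) = dist x y)}"

definition Aut :: "('k::field \<Rightarrow> 'x \<Rightarrow> 'x) \<Rightarrow> ('x::{banach, real_normed_algebra} \<Rightarrow> 'x) set"
  where "Aut s = {T. Vector_Spaces.linear s s T \<and> continuous_on UNIV T \<and> bij T \<and>
                     (\<forall>x y. T (x * y) = T x * T y)}"

definition ref_al :: "('k::field \<Rightarrow> 'x \<Rightarrow> 'x) \<Rightarrow>
    ('x::{banach, real_normed_algebra} \<Rightarrow> 'x) set \<Rightarrow> ('x \<Rightarrow> 'x) set"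
  where "ref_al s S = {T \<in> Bop s. \<forall>x. \<exists>L\<in>S. T x = L x}"

definition algebraically_reflexive :: "('k::field \<Rightarrow> 'x \<Rightarrow> 'x) \<Rightarrow>
    ('x::{banach, real_normed_algebra} \<Rightarrow> 'x) set \<Rightarrow> bool"
  where "algebraically_reflexive s S \<longleftrightarrow> ref_al s S = S"

lemma Iso_subset_Bop: "Iso s \<subseteq> Bop s"
  by (auto simp: Iso_def Bop_def continuous_on_iff)

lemma Aut_subset_Bop: "Aut s \<subseteq> Bop s"
  by (auto simp: Aut_def Bop_def)

end

theory Submission
  imports Defs
begin

text \<open>
  Neither group contains the following isometric homomorphism \<open>T\<close>, although \<open>T\<close> agrees at each
  function with some member of both groups.

  Write \<open>X = \<Gamma> \<union> {\<infinity>}\<close>. As \<open>\<Gamma>\<close> is infinite, there is a bijection \<open>\<beta> : \<Gamma> \<rightarrow> X\<close>. Extend it to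
  \<open>\<phi> : X \<rightarrow> X\<close> by \<open>\<phi>(\<infinity>) = \<infinity>\<close> and put \<open>T f = f \<circ> \<phi>\<close>. The map \<open>\<phi>\<close> is continuous and surjective, so
  \<open>T\<close> is an isometric algebra homomorphism. It is not onto: \<open>\<phi>\<close> identifies \<open>\<infinity>\<close> with
  \<open>\<beta>\<^sup>-\<^sup>1(\<infinity>) \<in> \<Gamma>\<close>, hence so does every function in the range of \<open>T\<close>.

  Now fix \<open>f\<close>. Continuity at \<open>\<infinity>\<close> makes \<open>{x. f x \<noteq> f \<infinity>}\<close> countable, so, \<open>\<Gamma>\<close> being uncountable,
  the level set \<open>{x. f x = f \<infinity>}\<close> is infinite and can absorb the point \<open>\<infinity>\<close>: some bijection
  \<open>e : X \<rightarrow> \<Gamma>\<close> satisfies \<open>f \<circ> e = f\<close> (lemma \<open>absorb_infinity\<close>). The permutation \<open>\<psi>\<close> of \<open>X\<close> given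
  by \<open>e \<circ> \<beta>\<close> on \<open>\<Gamma>\<close> and \<open>\<psi>(\<infinity>) = \<infinity>\<close> is a homeomorphism, and \<open>f \<circ> \<psi> = f \<circ> \<phi> = T f\<close>. Composition
  with \<open>\<psi>\<close> is both a surjective isometry and an automorphism, so \<open>T\<close> lies in both reflexive
  hulls. The scalar field enters only through its norm, and the real and complex cases are
  instances of one argument.
\<close>

section \<open>Self-maps of the one-point compactification\<close>

abbreviation infty :: "'g onept"
  where "infty \<equiv> onept_of_option None"

text \<open>
  The fibre over \<open>\<infinity>\<close> is left unrestricted, so that the lemma applies to the map \<open>\<phi>\<close>, which
  sends a second point to \<open>\<infinity>\<close>, and not only to permutations.
\<close>

lemma continuous_onept_self_map:
  fixes \<phi> :: "'g onept \<Rightarrow> 'g onept"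
  assumes "\<phi> infty = infty" and "inj_on \<phi> (- {infty})"
  shows "continuous_on UNIV \<phi>"
proof -
  have "open (\<phi> -` U)" if "open U" for U
    unfolding open_onept_iff
  proof
    assume "infty \<in> \<phi> -` U"
    then have U: "infty \<in> U" "finite (- U)"
      using assms(1) that open_onept_iff by auto
    have "- (\<phi> -` U) = \<phi> -` (- U) \<inter> - {infty}"
      using U assms(1) by auto
    then show "finite (- (\<phi> -` U))"
      using finite_vimage_IntI[OF U(2) assms(2)] by simp
  qed
  then show ?thesis
    by (simp add: continuous_on_open_vimage)
qed

lemma uncountable_finite_points:
  assumes "uncountable (UNIV :: 'g set)"
  shows "uncountable (- {infty :: 'g onept})"
proof
  assume "countable (- {infty :: 'g onept})"
  moreover have "range (onept_of_option \<circ> Some) \<subseteq> - {infty :: 'g onept}"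
    by (auto simp: onept_of_option_inject)
  ultimately have "countable (range (onept_of_option \<circ> Some :: 'g \<Rightarrow> 'g onept))"
    by (rule countable_subset[rotated])
  moreover have "inj (onept_of_option \<circ> Some :: 'g \<Rightarrow> 'g onept)"
    by (auto simp: inj_def onept_of_option_inject)
  ultimately show False
    using assms countable_image_inj_on by blast
qed

section \<open>Level sets of continuous functions\<close>

text \<open>
  Each neighbourhood of the value at \<open>\<infinity>\<close> contains all but finitely many values; the
  neighbourhoods of radius \<open>1 / (n + 1)\<close> together exhaust the support.
\<close>

lemma countable_support:
  fixes f :: "('g, 'k::metric_space) c_space"
  shows "countable {x. apply_bcontfun f x \<noteq> apply_bcontfun f infty}"
proof -
  let ?c = "apply_bcontfun f infty"
  let ?B = "\<lambda>n. apply_bcontfun f -` ball ?c (inverse (real (Suc n)))"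
  have "finite (- ?B n)" for n
  proof -
    have "continuous_on UNIV (apply_bcontfun f)"
      using apply_bcontfun bcontfun_def by blast
    then have "open (?B n)"
      by (intro open_vimage) auto
    then show ?thesis
      by (simp add: open_onept_iff)
  qed
  then have "countable (\<Union>n. - ?B n)"
    by (simp add: countable_finite)
  moreover have "{x. apply_bcontfun f x \<noteq> ?c} \<subseteq> (\<Union>n. - ?B n)"
  proof
    fix x assume "x \<in> {x. apply_bcontfun f x \<noteq> ?c}"
    then have "0 < dist ?c (apply_bcontfun f x)" by simp
    then obtain n where "inverse (real (Suc n)) < dist ?c (apply_bcontfun f x)"
      using reals_Archimedean by blast
    then show "x \<in> (\<Union>n. - ?B n)"
      by (intro UN_I[of n]) auto
  qed
  ultimately show ?thesis
    by (rule countable_subset[rotated])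
qed

text \<open>
  Hilbert's hotel inside the level set of the value at \<open>\<infinity>\<close>, which is infinite because its
  complement is countable; outside the level set \<open>e\<close> is the identity.
\<close>

lemma absorb_infinity:
  fixes f :: "('g, 'k::metric_space) c_space"
  assumes "uncountable (UNIV :: 'g set)"
  obtains e where "bij_betw e UNIV (- {infty :: 'g onept})"
    and "\<And>x. apply_bcontfun f (e x) = apply_bcontfun f x"
proof -
  define A where "A = {x. apply_bcontfun f x = apply_bcontfun f infty}"
  have "countable (- A)"
    using countable_support[of f] by (simp add: A_def Compl_eq)
  have "infinite A"
  proof
    assume "finite A"
    then have "countable (A \<union> - A)"
      using \<open>countable (- A)\<close> countable_Un countable_finite by blast
    then have "countable (- {infty :: 'g onept})"
      by (rule countable_subset[rotated]) auto
    with uncountable_finite_points[OF assms] show False by blast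
  qed
  from infinite_imp_bij_betw[OF this, of infty] obtain k
    where k: "bij_betw k A (A - {infty})" ..
  define e where "e x = (if x \<in> A then k x else x)" for x
  have "bij_betw e A (A - {infty})"
    using k by (subst bij_betw_cong[of A e k]) (auto simp: e_def)
  moreover have "bij_betw e (- A) (- A)"
    by (subst bij_betw_cong[of _ e id]) (auto simp: e_def)
  ultimately have "bij_betw e (A \<union> - A) ((A - {infty}) \<union> - A)"
    by (rule bij_betw_combine) auto
  moreover have "(A - {infty}) \<union> - A = - {infty}"
    by (auto simp: A_def)
  ultimately have "bij_betw e UNIV (- {infty})" by simp
  moreover have "apply_bcontfun f (e x) = apply_bcontfun f x" for x
    using bij_betwE[OF k] by (auto simp: e_def A_def)
  ultimately show thesis by (rule that)
qed

section \<open>Composition operators\<close>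

definition pullback :: "('g onept \<Rightarrow> 'g onept) \<Rightarrow> ('g, 'k::metric_space) c_space \<Rightarrow> ('g, 'k) c_space"
  where "pullback \<phi> f = Bcontfun (apply_bcontfun f \<circ> \<phi>)"

lemma apply_pullback:
  assumes "continuous_on UNIV \<phi>"
  shows "apply_bcontfun (pullback \<phi> f) x = apply_bcontfun f (\<phi> x)"
proof -
  have "continuous_on UNIV (apply_bcontfun f)"
    using apply_bcontfun bcontfun_def by blast
  then have "continuous_on UNIV (apply_bcontfun f \<circ> \<phi>)"
    using assms by (intro continuous_on_compose) (auto intro: continuous_on_subset)
  then have "apply_bcontfun f \<circ> \<phi> \<in> bcontfun"
    by (simp add: bcontfun_onept_eq)
  then show ?thesis
    by (simp add: pullback_def Bcontfun_inverse)
qed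

lemma linear_pullback:
  fixes \<phi> :: "'g onept \<Rightarrow> 'g onept"
  assumes "continuous_on UNIV \<phi>"
  shows "Vector_Spaces.linear scaleK scaleK
    (pullback \<phi> :: ('g, 'k::real_normed_field) c_space \<Rightarrow> ('g, 'k) c_space)"
  unfolding Vector_Spaces.linear_iff
  by (auto intro!: bcontfun_eqI simp: vector_space_scaleK apply_pullback[OF assms])

lemma pullback_mult:
  assumes "continuous_on UNIV \<phi>"
  shows "pullback \<phi> (f * g) =
    pullback \<phi> f * (pullback \<phi> g :: ('g, 'k::real_normed_field) c_space)"
  by (auto intro!: bcontfun_eqI simp: apply_pullback[OF assms])

lemma dist_pullback:
  fixes f g :: "('g, 'k::metric_space) c_space"
  assumes "continuous_on UNIV \<phi>" and "surj \<phi>"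
  shows "dist (pullback \<phi> f) (pullback \<phi> g) = dist f g"
proof (rule antisym)
  show "dist (pullback \<phi> f) (pullback \<phi> g) \<le> dist f g"
    by (rule dist_bound) (simp add: apply_pullback[OF assms(1)] dist_bounded)
  show "dist f g \<le> dist (pullback \<phi> f) (pullback \<phi> g)"
  proof (rule dist_bound)
    fix y
    obtain x where "y = \<phi> x" using assms(2) by auto
    then show "dist (apply_bcontfun f y) (apply_bcontfun g y)
        \<le> dist (pullback \<phi> f) (pullback \<phi> g)"
      using dist_bounded[of "pullback \<phi> f" x "pullback \<phi> g"]
      by (simp add: apply_pullback[OF assms(1)])
  qed
qed

lemma pullback_in_Bop:
  fixes \<phi> :: "'g onept \<Rightarrow> 'g onept"
  assumes "continuous_on UNIV \<phi>" and "surj \<phi>"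
  shows "(pullback \<phi> :: ('g, 'k::{real_normed_field, banach}) c_space \<Rightarrow> _) \<in> Bop scaleK"
proof -
  have "continuous_on UNIV (pullback \<phi> :: ('g, 'k) c_space \<Rightarrow> _)"
    unfolding continuous_on_iff dist_pullback[OF assms] by blast
  then show ?thesis
    using linear_pullback[OF assms(1)] by (simp add: Bop_def)
qed

lemma pullback_permutation:
  fixes \<psi> :: "'g onept \<Rightarrow> 'g onept"
  assumes "bij \<psi>" and "\<psi> infty = infty"
  shows "(pullback \<psi> :: ('g, 'k::{real_normed_field, banach}) c_space \<Rightarrow> _)
    \<in> Iso scaleK \<inter> Aut scaleK"
proof -
  let ?T = "pullback \<psi> :: ('g, 'k) c_space \<Rightarrow> _"
  have cont: "continuous_on UNIV \<psi>"
    using assms by (intro continuous_onept_self_map) (auto simp: bij_def intro: inj_on_subset)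
  have "surj \<psi>" and "inj \<psi>"
    using assms(1) by (auto simp: bij_def)
  have "inv \<psi> infty = infty"
    using assms(2) \<open>inj \<psi>\<close> by (metis inv_f_f)
  moreover have "inj (inv \<psi>)"
    using \<open>surj \<psi>\<close> by (rule surj_imp_inj_inv)
  ultimately have cont_inv: "continuous_on UNIV (inv \<psi>)"
    by (intro continuous_onept_self_map) (auto intro: inj_on_subset)
  have "?T (pullback (inv \<psi>) f) = f" for f
    using \<open>inj \<psi>\<close> by (intro bcontfun_eqI) (simp add: apply_pullback cont cont_inv)
  then have "surj ?T" by (metis surjI)
  moreover have iso: "dist (?T f) (?T g) = dist f g" for f g
    using cont \<open>surj \<psi>\<close> by (rule dist_pullback)
  moreover have "inj ?T"
  proof (rule injI)
    fix f g assume "?T f = ?T g"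
    then show "f = g" using iso[of f g] by simp
  qed
  ultimately show ?thesis
    using linear_pullback[OF cont, where ?'k = 'k] pullback_mult[OF cont, where ?'k = 'k]
      pullback_in_Bop[OF cont \<open>surj \<psi>\<close>, where ?'k = 'k]
    by (auto simp: Iso_def Aut_def Bop_def bij_def)
qed

text \<open>The indicator function of an isolated point that \<open>\<phi>\<close> identifies with \<open>\<infinity>\<close> is not attained.\<close>

lemma not_surj_pullback:
  fixes \<phi> :: "'g onept \<Rightarrow> 'g onept"
  assumes "continuous_on UNIV \<phi>" and "p \<noteq> infty" and "\<phi> p = \<phi> infty"
  shows "\<not> surj (pullback \<phi> :: ('g, 'k::real_normed_field) c_space \<Rightarrow> _)"
proof
  assume surj: "surj (pullback \<phi> :: ('g, 'k) c_space \<Rightarrow> _)"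
  let ?h = "\<lambda>x. if x = p then 1 else 0 :: 'k"
  have "open (?h -` U)" for U
  proof -
    have "- (?h -` U) \<subseteq> {p}" if "infty \<in> ?h -` U"
      using that assms(2) by auto
    then show ?thesis
      unfolding open_onept_iff using finite_subset by blast
  qed
  then have "continuous_on UNIV ?h"
    by (simp add: continuous_on_open_vimage)
  then have h: "apply_bcontfun (Bcontfun ?h) = ?h"
    by (intro Bcontfun_inverse) (simp add: bcontfun_onept_eq)
  obtain f where "pullback \<phi> f = Bcontfun ?h"
    using surj by (metis surjD)
  then have "apply_bcontfun f (\<phi> p) = ?h p" "apply_bcontfun f (\<phi> infty) = ?h infty"
    using h by (metis apply_pullback[OF assms(1)])+
  with assms(2,3) show False by simp
qed

section \<open>Failure of algebraic reflexivity\<close>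

text \<open>
  One operator \<open>T\<close> witnesses the failure of reflexivity for every set of surjective operators
  that contains all the compositions with permutations of \<open>\<Gamma>\<close>.
\<close>

lemma not_algebraically_reflexive:
  fixes S :: "(('g, 'k::{real_normed_field, banach}) c_space \<Rightarrow> ('g, 'k) c_space) set"
  assumes unc: "uncountable (UNIV :: 'g set)"
    and S: "Iso scaleK \<inter> Aut scaleK \<subseteq> S" "\<And>L. L \<in> S \<Longrightarrow> surj L"
  shows "\<not> algebraically_reflexive scaleK S"
proof -
  have "infinite (- {infty :: 'g onept})"
    using uncountable_finite_points[OF unc] countable_finite by blast
  from infinite_imp_bij_betw2[OF this, of infty] obtain \<beta> where
    "bij_betw \<beta> (- {infty :: 'g onept}) (- {infty :: 'g onept} \<union> {infty})" ..
  then have \<beta>: "bij_betw \<beta> (- {infty :: 'g onept}) UNIV"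
    by (simp only: Compl_partition2)
  define \<phi> where "\<phi> x = (if x = infty then infty else \<beta> x)" for x
  have "inj_on \<phi> (- {infty})"
    using \<beta> by (auto simp: bij_betw_def inj_on_def \<phi>_def)
  then have cont: "continuous_on UNIV \<phi>"
    by (intro continuous_onept_self_map) (auto simp: \<phi>_def)
  have "\<exists>x. x \<noteq> infty \<and> \<phi> x = y" for y
  proof -
    have "y \<in> \<beta> ` (- {infty})" using \<beta> by (simp add: bij_betw_def)
    then show ?thesis by (auto simp: \<phi>_def)
  qed
  then have "surj \<phi>" and "\<exists>p. p \<noteq> infty \<and> \<phi> p = \<phi> infty"
    by (metis surjI, blast)
  let ?T = "pullback \<phi> :: ('g, 'k) c_space \<Rightarrow> _"
  have "\<exists>L\<in>S. ?T f = L f" for f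
  proof -
    obtain e where e: "bij_betw e UNIV (- {infty :: 'g onept})"
      and fe: "\<And>x. apply_bcontfun f (e x) = apply_bcontfun f x"
      using absorb_infinity[OF unc, of f] by blast
    define \<psi> where "\<psi> x = (if x = infty then infty else e (\<beta> x))" for x
    have "bij_betw (e \<circ> \<beta>) (- {infty}) (- {infty})"
      using \<beta> e by (rule bij_betw_trans)
    then have "bij_betw \<psi> (- {infty}) (- {infty})"
      by (subst bij_betw_cong[of _ \<psi> "e \<circ> \<beta>"]) (auto simp: \<psi>_def)
    moreover have "bij_betw \<psi> {infty} {infty}"
      by (simp add: bij_betw_def \<psi>_def)
    ultimately have "bij_betw \<psi> (- {infty} \<union> {infty}) (- {infty} \<union> {infty})"
      by (rule bij_betw_combine) auto
    then have "bij \<psi>"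
      by (simp only: Compl_partition2)
    have \<psi>_infty: "\<psi> infty = infty" by (simp add: \<psi>_def)
    have "continuous_on UNIV \<psi>"
      using \<psi>_infty \<open>bij \<psi>\<close>
      by (intro continuous_onept_self_map) (auto simp: bij_def intro: inj_on_subset)
    moreover have "apply_bcontfun f (\<phi> x) = apply_bcontfun f (\<psi> x)" for x
      by (simp add: \<phi>_def \<psi>_def fe)
    ultimately have "?T f = pullback \<psi> f"
      by (intro bcontfun_eqI) (simp add: apply_pullback cont)
    moreover have "pullback \<psi> \<in> S"
      using pullback_permutation[OF \<open>bij \<psi>\<close> \<psi>_infty] S(1) by blast
    ultimately show ?thesis by blast
  qed
  then have "?T \<in> ref_al scaleK S"
    using pullback_in_Bop[OF cont \<open>surj \<phi>\<close>] by (simp add: ref_al_def)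
  moreover have "?T \<notin> S"
    using not_surj_pullback[OF cont, where ?'k = 'k] S(2)
      \<open>\<exists>p. p \<noteq> infty \<and> \<phi> p = \<phi> infty\<close> by blast
  ultimately show ?thesis
    by (auto simp: algebraically_reflexive_def)
qed

theorem mainTheorem11:
  assumes "uncountable (UNIV :: 'g set)"
  shows "(\<not> algebraically_reflexive (scaleK :: real \<Rightarrow> ('g, real) c_space \<Rightarrow> ('g, real) c_space)
            (Iso scaleK) \<and>
          \<not> algebraically_reflexive (scaleK :: real \<Rightarrow> ('g, real) c_space \<Rightarrow> ('g, real) c_space)
            (Aut scaleK)) \<and>
         (\<not> algebraically_reflexive (scaleK :: complex \<Rightarrow> ('g, complex) c_space \<Rightarrow> ('g, complex) c_space)
            (Iso scaleK) \<and>
          \<not> algebraically_reflexive (scaleK :: complex \<Rightarrow> ('g, complex) c_space \<Rightarrow> ('g, complex) c_space)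
            (Aut scaleK))"
  by (intro conjI not_algebraically_reflexive assms) (auto simp: Iso_def Aut_def bij_def)

end
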